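(* If the functions $f,g:\mathbb{H}\to\mathbb{H}$ have the left GHR derivatives, then so too has their product $fg$ (defined by $(fg)(q)=f(q)g(q)$), and for $\mu\in\mathbb{H}$, $\mu\neq 0$, $$\frac{\partial (fg)}{\partial q^{\mu}}=f\,\frac{\partial g}{\partial q^{\mu}}+\frac{\partial f}{\partial q^{g\mu}}\,g,\qquad \frac{\partial (fg)}{\partial q^{\mu*}}=f\,\frac{\partial g}{\partial q^{\mu*}}+\frac{\partial f}{\partial q^{g\mu*}}\,g ,$$ where $\frac{\partial f}{\partial q^{g\mu}}$ and $\frac{\partial f}{\partial q^{g\mu*}}$ are obtained by replacing $\mu$ with $g\mu$ in the definition of the left GHR derivatives $\frac{\partial f}{\partial q^{\mu}}$ and $\frac{\partial f}{\partial q^{\mu*}}$ of $f$.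
   Context: $\mathbb{H}$ denotes the real quaternions $q=q_a+iq_b+jq_c+kq_d$ with $q_a,q_b,q_c,q_d\in\mathbb{R}$ and $i^2=j^2=k^2=ijk=-1$. The conjugate is $q^*=q_a-iq_b-jq_c-kq_d$. For $\mu\in\mathbb{H}$, $\mu\ne0$, and $p\in\mathbb{H}$, write $p^{\mu}:=\mu p\mu^{-1}$ and $p^{\mu*}:=(p^{\mu})^*$; a product in the exponent, such as $p^{\nu\mu}$, means rotation by the quaternion product $\nu\mu$, and $p^{\nu\mu *}=(p^{\nu\mu})^*$. A function $f:\mathbb{H}\to\mathbb{H}$ is regarded as a function of the four real variables $q_a,q_b,q_c,q_d$, and $\frac{\partial f}{\partial q_a},\dots,\frac{\partial f}{\partial q_d}$ are its ($\mathbb{H}$-valued) partial derivatives. For $\mu\in\mathbb{H}$, $\mu\neq0$, the left GHR derivatives of $f$ with respect to $q^{\mu}$ and $q^{\mu*}$ are $$\frac{\partial f}{\partial q^{\mu}}=\frac14\left(\frac{\partial f}{\partial q_a}-\frac{\partial f}{\partial q_b}i^{\mu}-\frac{\partial f}{\partial q_c}j^{\mu}-\frac{\partial f}{\partial q_d}k^{\mu}\right),\qquad \frac{\partial f}{\partial q^{\mu*}}=\frac14\left(\frac{\partial f}{\partial q_a}+\frac{\partial f}{\partial q_b}i^{\mu}+\frac{\partial f}{\partial q_c}j^{\mu}+\frac{\partial f}{\partial q_d}k^{\mu}\right).$$ In $\frac{\partial f}{\partial q^{g\mu}}$ and $\frac{\partial f}{\partial q^{g\mu*}}$ the rotation quaternion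 at a point $q$ is $g(q)\mu$. *)

theory Defs
  imports "HOL-Analysis.Analysis"
begin

text \<open>The real quaternions: \<open>Quat a b c d\<close> stands for \<open>a + i b + j c + k d\<close>.\<close>

datatype quat = Quat (qa: real) (qb: real) (qc: real) (qd: real)

lemma quat_eq_iff: "p = q \<longleftrightarrow> qa p = qa q \<and> qb p = qb q \<and> qc p = qc q \<and> qd p = qd q"
  by (cases p; cases q) simp

instantiation quat :: ab_group_add
begin

definition zero_quat :: quat where "0 = Quat 0 0 0 0"

definition plus_quat :: "quat \<Rightarrow> quat \<Rightarrow> quat" where
  "p + q = Quat (qa p + qa q) (qb p + qb q) (qc p + qc q) (qd p + qd q)"

definition uminus_quat :: "quat \<Rightarrow> quat" where
  "- p = Quat (- qa p) (- qb p) (- qc p) (- qd p)"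

definition minus_quat :: "quat \<Rightarrow> quat \<Rightarrow> quat" where
  "p - q = Quat (qa p - qa q) (qb p - qb q) (qc p - qc q) (qd p - qd q)"

instance
  by standard (simp_all add: zero_quat_def plus_quat_def uminus_quat_def minus_quat_def)

end

instantiation quat :: real_vector
begin

definition scaleR_quat :: "real \<Rightarrow> quat \<Rightarrow> quat" where
  "r *\<^sub>R p = Quat (r * qa p) (r * qb p) (r * qc p) (r * qd p)"

instance
  by standard (simp_all add: scaleR_quat_def plus_quat_def algebra_simps)

end

text \<open>The metric and the topology are those of the Euclidean space of dimension four.\<close>

instantiation quat :: real_inner
begin

definition inner_quat :: "quat \<Rightarrow> quat \<Rightarrow> real" where
  "p \<bullet> q = qa p * qa q + qb p * qb q + qc p * qc q + qd p * qd q"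

definition norm_quat :: "quat \<Rightarrow> real" where "norm p = sqrt (p \<bullet> p)" for p :: quat

definition sgn_quat :: "quat \<Rightarrow> quat" where "sgn p = p /\<^sub>R norm p" for p :: quat

definition dist_quat :: "quat \<Rightarrow> quat \<Rightarrow> real" where "dist p q = norm (p - q)" for p q :: quat

definition uniformity_quat :: "(quat \<times> quat) filter" where
  "(uniformity :: (quat \<times> quat) filter) = (INF e\<in>{0<..}. principal {(p :: quat, q). dist p q < e})"

definition open_quat :: "quat set \<Rightarrow> bool" where
  "open U \<longleftrightarrow> (\<forall>p\<in>U. eventually (\<lambda>(p', q). p' = p \<longrightarrow> q \<in> U) uniformity)" for U :: "quat set"

instance
proof
  fix p q s :: quat and r :: real and U :: "quat set"
  show "dist p q = norm (p - q)" by (fact dist_quat_def)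
  show "sgn p = p /\<^sub>R norm p" by (fact sgn_quat_def)
  show "(uniformity :: (quat \<times> quat) filter) =
      (INF e\<in>{0<..}. principal {(x, y). dist x y < e})"
    by (fact uniformity_quat_def)
  show "open U \<longleftrightarrow> (\<forall>x\<in>U. \<forall>\<^sub>F (x', y) in uniformity. x' = x \<longrightarrow> y \<in> U)"
    by (fact open_quat_def)
  show "p \<bullet> q = q \<bullet> p" by (simp add: inner_quat_def mult.commute)
  show "(p + q) \<bullet> s = p \<bullet> s + q \<bullet> s"
    by (simp add: inner_quat_def plus_quat_def algebra_simps)
  show "r *\<^sub>R p \<bullet> q = r * (p \<bullet> q)"
    by (simp add: inner_quat_def scaleR_quat_def algebra_simps)
  show "0 \<le> p \<bullet> p" by (simp add: inner_quat_def)
  show "p \<bullet> p = 0 \<longleftrightarrow> p = 0"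
    by (simp add: inner_quat_def zero_quat_def quat_eq_iff add_nonneg_eq_0_iff)
  show "norm p = sqrt (p \<bullet> p)" by (fact norm_quat_def)
qed

end

text \<open>
  The inverse is the conjugate divided by the squared norm; as in every HOL division ring,
  \<open>inverse 0 = 0\<close>.
\<close>

instantiation quat :: real_normed_div_algebra
begin

definition one_quat :: quat where "1 = Quat 1 0 0 0"

definition times_quat :: "quat \<Rightarrow> quat \<Rightarrow> quat" where
  "p * q = Quat
    (qa p * qa q - qb p * qb q - qc p * qc q - qd p * qd q)
    (qa p * qb q + qb p * qa q + qc p * qd q - qd p * qc q)
    (qa p * qc q - qb p * qd q + qc p * qa q + qd p * qb q)
    (qa p * qd q + qb p * qc q - qc p * qb q + qd p * qa q)"

definition inverse_quat :: "quat \<Rightarrow> quat" where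
  "inverse p = Quat (qa p) (- qb p) (- qc p) (- qd p) /\<^sub>R (p \<bullet> p)"

definition divide_quat :: "quat \<Rightarrow> quat \<Rightarrow> quat" where
  "p div q = p * inverse q" for p q :: quat

instance
proof
  fix p q s :: quat and r :: real
  show "p * q * s = p * (q * s)" by (simp add: times_quat_def algebra_simps)
  show "1 * p = p" by (simp add: times_quat_def one_quat_def)
  show "p * 1 = p" by (simp add: times_quat_def one_quat_def)
  show "(p + q) * s = p * s + q * s" by (simp add: times_quat_def plus_quat_def algebra_simps)
  show "p * (q + s) = p * q + p * s" by (simp add: times_quat_def plus_quat_def algebra_simps)
  show "(0 :: quat) \<noteq> 1" by (simp add: zero_quat_def one_quat_def)
  show "r *\<^sub>R p * q = r *\<^sub>R (p * q)" by (simp add: times_quat_def scaleR_quat_def algebra_simps)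
  show "p * r *\<^sub>R q = r *\<^sub>R (p * q)" by (simp add: times_quat_def scaleR_quat_def algebra_simps)
  show "inverse (0 :: quat) = 0"
    by (simp add: inverse_quat_def zero_quat_def scaleR_quat_def inner_quat_def)
  show "p div q = p * inverse q" by (fact divide_quat_def)
  let ?c = "Quat (qa p) (- qb p) (- qc p) (- qd p)"
  have cp: "?c * p = Quat (p \<bullet> p) 0 0 0" and pc: "p * ?c = Quat (p \<bullet> p) 0 0 0"
    by (simp_all add: times_quat_def inner_quat_def algebra_simps)
  have l: "r *\<^sub>R x * y = r *\<^sub>R (x * y)" and m: "x * r *\<^sub>R y = r *\<^sub>R (x * y)" for x y :: quat and r
    by (simp_all add: times_quat_def scaleR_quat_def algebra_simps)
  show "inverse p * p = 1" if "p \<noteq> 0"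
    using that unfolding inverse_quat_def l cp by (simp add: scaleR_quat_def one_quat_def)
  show "p * inverse p = 1" if "p \<noteq> 0"
    using that unfolding inverse_quat_def m pc by (simp add: scaleR_quat_def one_quat_def)
  have "(p * q) \<bullet> (p * q) = (p \<bullet> p) * (q \<bullet> q)"
    by (simp add: times_quat_def inner_quat_def) algebra
  then show "norm (p * q) = norm p * norm q"
    by (simp add: norm_quat_def real_sqrt_mult)
qed

end

definition qi :: quat where "qi = Quat 0 1 0 0"
definition qj :: quat where "qj = Quat 0 0 1 0"
definition qk :: quat where "qk = Quat 0 0 0 1"

lemma quat_expansion: "Quat a b c d = a *\<^sub>R 1 + b *\<^sub>R qi + c *\<^sub>R qj + d *\<^sub>R qk"
  by (simp add: one_quat_def qi_def qj_def qk_def plus_quat_def scaleR_quat_def)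

lemma quat_units: "qi * qi = - 1" "qj * qj = - 1" "qk * qk = - 1" "qi * qj * qk = - 1"
  by (simp_all add: one_quat_def qi_def qj_def qk_def times_quat_def uminus_quat_def)

definition qrot :: "quat \<Rightarrow> quat \<Rightarrow> quat" where
  "qrot \<mu> p = \<mu> * p * inverse \<mu>"

text \<open>
  \<open>quat_partial e f q\<close> for \<open>e\<close> one of \<open>1\<close>, \<open>qi\<close>, \<open>qj\<close>, \<open>qk\<close> is the partial derivative of
  \<open>f\<close> at \<open>q\<close> with respect to the real coordinate of \<open>q\<close> along \<open>e\<close>. It is meaningful only
  where that derivative exists.
\<close>

definition quat_partial :: "quat \<Rightarrow> (quat \<Rightarrow> quat) \<Rightarrow> quat \<Rightarrow> quat" where
  "quat_partial e f q = vector_derivative (\<lambda>t. f (q + t *\<^sub>R e)) (at 0)"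

text \<open>
  The left GHR derivatives are finite combinations of the four partial derivatives, so having
  them at \<open>q\<close> means that these partial derivatives exist at \<open>q\<close>, whatever the rotation \<open>\<mu>\<close>.
\<close>

definition has_left_GHR :: "(quat \<Rightarrow> quat) \<Rightarrow> quat \<Rightarrow> bool" where
  "has_left_GHR f q \<longleftrightarrow> (\<forall>e\<in>{1, qi, qj, qk}. (\<lambda>t. f (q + t *\<^sub>R e)) differentiable (at 0))"

text \<open>
  \<open>left_GHR \<mu> f q\<close> and \<open>left_GHR_conj \<mu> f q\<close> are the left GHR derivatives of \<open>f\<close> at \<open>q\<close> with
  respect to \<open>q\<^sup>\<mu>\<close> and to the conjugate of \<open>q\<^sup>\<mu>\<close>; they are meaningful for \<open>\<mu> \<noteq> 0\<close>.
\<close>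

definition left_GHR :: "quat \<Rightarrow> (quat \<Rightarrow> quat) \<Rightarrow> quat \<Rightarrow> quat" where
  "left_GHR \<mu> f q = (1/4) *\<^sub>R
    (quat_partial 1 f q - quat_partial qi f q * qrot \<mu> qi
      - quat_partial qj f q * qrot \<mu> qj - quat_partial qk f q * qrot \<mu> qk)"

definition left_GHR_conj :: "quat \<Rightarrow> (quat \<Rightarrow> quat) \<Rightarrow> quat \<Rightarrow> quat" where
  "left_GHR_conj \<mu> f q = (1/4) *\<^sub>R
    (quat_partial 1 f q + quat_partial qi f q * qrot \<mu> qi
      + quat_partial qj f q * qrot \<mu> qj + quat_partial qk f q * qrot \<mu> qk)"

end

theory Submission
  imports Defs
begin

text \<open>
  Each partial derivative obeys the ordinary Leibniz rule \<open>(f g)' = f g' + f' g\<close>, provided the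
  order of the factors is kept. In a left GHR derivative the partial derivatives are then
  multiplied from the right by the rotated units \<open>u\<^sup>\<mu>\<close>. The summand \<open>f g'\<close> causes no trouble, since
  \<open>f\<close> stands on the far left and factors out. In the summand \<open>f' g u\<^sup>\<mu>\<close> the value of \<open>g\<close>
  separates \<open>f'\<close> from the unit, and it has to be moved to the far right. This is a conjugation by
  \<open>g\<close>, that is, a further rotation: \<open>g u\<^sup>\<mu> = u\<^sup>g\<^sup>\<mu> g\<close> (lemma \<open>mult_qrot\<close>). Hence the
  rotation by \<open>g \<mu>\<close> in the term with the derivative of \<open>f\<close>.

  Where \<open>g\<close> vanishes, the rotation by \<open>g \<mu> = 0\<close> is the zero map, and the commutation rule reads
  \<open>0 = 0\<close>, so the product rule holds at such points too.
\<close>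

text \<open>
  Moving a factor past a rotated quaternion changes the rotation, since
  \<open>p (\<mu> u \<mu>\<inverse>) = (p \<mu> u \<mu>\<inverse> p\<inverse>) p\<close> for \<open>p \<noteq> 0\<close>.
\<close>

lemma mult_qrot: "p * qrot \<mu> u = qrot (p * \<mu>) u * p"
proof (cases "p = 0 \<or> \<mu> = 0")
  case True
  then show ?thesis by (auto simp: qrot_def)
next
  case False
  then show ?thesis by (simp add: qrot_def nonzero_inverse_mult_distrib mult.assoc)
qed

lemma has_vector_derivative_quat_partial:
  assumes "(\<lambda>t. f (q + t *\<^sub>R e)) differentiable (at 0)"
  shows "((\<lambda>t. f (q + t *\<^sub>R e)) has_vector_derivative quat_partial e f q) (at 0)"
  using assms unfolding quat_partial_def by (simp add: vector_derivative_works)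

lemma has_vector_derivative_along_mult:
  assumes "(\<lambda>t. f (q + t *\<^sub>R e)) differentiable (at 0)"
    and "(\<lambda>t. g (q + t *\<^sub>R e)) differentiable (at 0)"
  shows "((\<lambda>t. f (q + t *\<^sub>R e) * g (q + t *\<^sub>R e)) has_vector_derivative
      f q * quat_partial e g q + quat_partial e f q * g q) (at 0)"
  using has_vector_derivative_mult[OF assms[THEN has_vector_derivative_quat_partial]] by simp

lemma quat_partial_mult:
  assumes "(\<lambda>t. f (q + t *\<^sub>R e)) differentiable (at 0)"
    and "(\<lambda>t. g (q + t *\<^sub>R e)) differentiable (at 0)"
  shows "quat_partial e (\<lambda>x. f x * g x) q = f q * quat_partial e g q + quat_partial e f q * g q"
  using has_vector_derivative_along_mult[OF assms]
  by (simp add: quat_partial_def vector_derivative_at)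

text \<open>
  The product rule for a single summand of a left GHR derivative, already in the form in which
  \<open>f q\<close> and \<open>g q\<close> factor out of the whole sum on the left and on the right.
\<close>

lemma quat_partial_mult_qrot:
  assumes "(\<lambda>t. f (q + t *\<^sub>R e)) differentiable (at 0)"
    and "(\<lambda>t. g (q + t *\<^sub>R e)) differentiable (at 0)"
  shows "quat_partial e (\<lambda>x. f x * g x) q * qrot \<mu> u
    = f q * (quat_partial e g q * qrot \<mu> u)
      + (quat_partial e f q * qrot (g q * \<mu>) u) * g q"
  by (simp add: quat_partial_mult[OF assms] distrib_right mult.assoc mult_qrot[of "g q"])

lemma has_left_GHR_mult:
  assumes "has_left_GHR f q" and "has_left_GHR g q"
  shows "has_left_GHR (\<lambda>x. f x * g x) q"
  using assms has_vector_derivative_along_mult unfolding has_left_GHR_def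
  by (blast intro: differentiableI_vector)

theorem theorem3p1:
  fixes f g :: "quat \<Rightarrow> quat" and \<mu> q :: quat
  assumes "has_left_GHR f q"
    and "has_left_GHR g q"
    and "\<mu> \<noteq> 0"
  shows "has_left_GHR (\<lambda>x. f x * g x) q
    \<and> left_GHR \<mu> (\<lambda>x. f x * g x) q
        = f q * left_GHR \<mu> g q + left_GHR (g q * \<mu>) f q * g q
    \<and> left_GHR_conj \<mu> (\<lambda>x. f x * g x) q
        = f q * left_GHR_conj \<mu> g q + left_GHR_conj (g q * \<mu>) f q * g q"
proof (intro conjI)
  show "has_left_GHR (\<lambda>x. f x * g x) q"
    using assms(1,2) by (rule has_left_GHR_mult)
  have along: "(\<lambda>t. f (q + t *\<^sub>R e)) differentiable (at 0)"
      "(\<lambda>t. g (q + t *\<^sub>R e)) differentiable (at 0)" if "e \<in> {1, qi, qj, qk}" for e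
    using assms(1,2) that unfolding has_left_GHR_def by blast+
  have real_part: "quat_partial 1 (\<lambda>x. f x * g x) q
      = f q * quat_partial 1 g q + quat_partial 1 f q * g q"
    by (rule quat_partial_mult) (simp_all add: along)
  have imaginary_part: "quat_partial e (\<lambda>x. f x * g x) q * qrot \<mu> e
      = f q * (quat_partial e g q * qrot \<mu> e)
        + (quat_partial e f q * qrot (g q * \<mu>) e) * g q" if "e \<in> {qi, qj, qk}" for e
    using that by (intro quat_partial_mult_qrot along) auto
  show "left_GHR \<mu> (\<lambda>x. f x * g x) q
      = f q * left_GHR \<mu> g q + left_GHR (g q * \<mu>) f q * g q"
    by (simp add: left_GHR_def real_part imaginary_part algebra_simps del: mult.assoc)
  show "left_GHR_conj \<mu> (\<lambda>x. f x * g x) q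
      = f q * left_GHR_conj \<mu> g q + left_GHR_conj (g q * \<mu>) f q * g q"
    by (simp add: left_GHR_conj_def real_part imaginary_part algebra_simps del: mult.assoc)
qed

end
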